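(* Let $\Omega=[0,1]$. Let $f$ and $g$ be two non-zero functions in $L^2(\Omega)$ with $g=\lambda f$, where $\lambda$ is a non-zero real constant. Then the angle $\theta$ between $f$ and $g$ is $$\theta=\begin{cases}0, & \text{if }\lambda>0,\\ \pi, & \text{if }\lambda<0.\end{cases}$$
   Context: $L^2(\Omega)$ is the real Hilbert space of (classes of) measurable functions $f:\Omega\to\mathbb{R}$ with $\int_\Omega f^2\,dx<\infty$, with inner product $\langle f,g\rangle=\int_\Omega f(x)g(x)\,dx$ and norm $\|f\|=\sqrt{\langle f,f\rangle}$. The angle between non-zero $f,g\in L^2(\Omega)$ is defined as $\theta=\cos^{-1}\left(\frac{\langle f,g\rangle}{\|f\|\,\|g\|}\right)\in[0,\pi]$. *)

theory Defs
  imports "HOL-Analysis.Analysis"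
begin

text \<open>
  Elements of \<open>L\<^sup>2(\<Omega>)\<close> are handled through representatives: functions on the ambient space, of
  which only the values on \<open>\<Omega>\<close> matter, with almost-everywhere equality on \<open>\<Omega>\<close> as equality.
  Measurability and integration refer to Lebesgue measure restricted to \<open>\<Omega>\<close>.
\<close>

definition L2 :: "'a::euclidean_space set \<Rightarrow> ('a \<Rightarrow> real) set" where
  "L2 \<Omega> = {f. f \<in> borel_measurable (lebesgue_on \<Omega>) \<and>
               integrable (lebesgue_on \<Omega>) (\<lambda>x. (f x)\<^sup>2)}"

definition L2_eq :: "'a::euclidean_space set \<Rightarrow> ('a \<Rightarrow> real) \<Rightarrow> ('a \<Rightarrow> real) \<Rightarrow> bool" where
  "L2_eq \<Omega> f g \<longleftrightarrow> (AE x in lebesgue_on \<Omega>. f x = g x)"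

definition L2_inner :: "'a::euclidean_space set \<Rightarrow> ('a \<Rightarrow> real) \<Rightarrow> ('a \<Rightarrow> real) \<Rightarrow> real" where
  "L2_inner \<Omega> f g = (LINT x|lebesgue_on \<Omega>. f x * g x)"

definition L2_norm :: "'a::euclidean_space set \<Rightarrow> ('a \<Rightarrow> real) \<Rightarrow> real" where
  "L2_norm \<Omega> f = sqrt (L2_inner \<Omega> f f)"

definition L2_angle :: "'a::euclidean_space set \<Rightarrow> ('a \<Rightarrow> real) \<Rightarrow> ('a \<Rightarrow> real) \<Rightarrow> real" where
  "L2_angle \<Omega> f g = arccos (L2_inner \<Omega> f g / (L2_norm \<Omega> f * L2_norm \<Omega> g))"

text \<open>The inner product, and hence the norm and the angle, depend only on the classes.\<close>

lemma L2_inner_cong: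
  assumes "f \<in> L2 \<Omega>" "f' \<in> L2 \<Omega>" "g \<in> L2 \<Omega>" "g' \<in> L2 \<Omega>"
    and "L2_eq \<Omega> f f'" "L2_eq \<Omega> g g'"
  shows "L2_inner \<Omega> f g = L2_inner \<Omega> f' g'"
  unfolding L2_inner_def
proof (rule integral_cong_AE)
  show "AE x in lebesgue_on \<Omega>. f x * g x = f' x * g' x"
    using assms(5,6) unfolding L2_eq_def by eventually_elim simp
qed (use assms in \<open>auto simp: L2_def\<close>)

lemma L2_angle_cong:
  assumes "f \<in> L2 \<Omega>" "f' \<in> L2 \<Omega>" "g \<in> L2 \<Omega>" "g' \<in> L2 \<Omega>"
    and "L2_eq \<Omega> f f'" "L2_eq \<Omega> g g'"
  shows "L2_angle \<Omega> f g = L2_angle \<Omega> f' g'"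
  unfolding L2_angle_def L2_norm_def
  using L2_inner_cong[OF assms] L2_inner_cong[of f \<Omega> f' f f'] L2_inner_cong[of g \<Omega> g' g g'] assms
  by simp

end

theory Submission imports Defs begin

text \<open>Pairing \<open>f\<close> with \<open>c * f\<close> gives \<open>c\<close> times the
  squared norm of \<open>f\<close>, while the product of the two norms is
  \<open>\<bar>c\<bar>\<close> times the same number. That number is positive because the class of
  \<open>f\<close> is non-zero (\<open>L2_inner_self_pos\<close>), so it cancels and the cosine is
  \<open>sgn c\<close> (\<open>L2_angle_scale\<close>), that is 1 or -1. Since \<open>g\<close>
  agrees with \<open>c * f\<close> only almost everywhere, \<open>L2_angle_cong\<close> carries the
  result over to \<open>g\<close>.\<close>

lemma L2_inner_scale_right: "L2_inner \<Omega> f (\<lambda>x. c * g x) = c * L2_inner \<Omega> f g"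
  unfolding L2_inner_def by (simp add: mult.left_commute)

lemma L2_norm_scale: "L2_norm \<Omega> (\<lambda>x. c * f x) = \<bar>c\<bar> * L2_norm \<Omega> f"
proof -
  have "(\<lambda>x. (c * f x) * (c * f x)) = (\<lambda>x. c\<^sup>2 * (f x * f x))"
    by (simp add: fun_eq_iff power2_eq_square)
  then show ?thesis
    by (simp add: L2_norm_def L2_inner_def real_sqrt_mult)
qed

lemma L2_scale: "f \<in> L2 \<Omega> \<Longrightarrow> (\<lambda>x. c * f x) \<in> L2 \<Omega>"
  by (auto simp: L2_def power_mult_distrib)

text \<open>A non-negative integrable function with integral 0 vanishes almost everywhere, and
  \<open>f x * f x\<close> vanishes exactly where \<open>f x\<close> does.\<close>

lemma L2_inner_self_pos:
  assumes "f \<in> L2 \<Omega>" "\<not> L2_eq \<Omega> f (\<lambda>x. 0)"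
  shows "0 < L2_inner \<Omega> f f"
proof -
  \<comment> \<open>Integrability matters here: a non-integrable function has integral 0 by
    convention, so a zero integral alone would not force \<open>f\<close> to vanish.\<close>
  have "integrable (lebesgue_on \<Omega>) (\<lambda>x. f x * f x)"
    using assms(1) by (simp add: L2_def power2_eq_square)
  then have "L2_inner \<Omega> f f \<noteq> 0"
    using assms(2) by (simp add: L2_inner_def L2_eq_def integral_nonneg_eq_0_iff_AE)
  moreover have "0 \<le> L2_inner \<Omega> f f"
    by (simp add: L2_inner_def)
  ultimately show ?thesis by simp
qed

lemma L2_eq_refl: "L2_eq \<Omega> f f"
  by (simp add: L2_eq_def)

text \<open>Using \<open>sgn c\<close> treats both signs at once. It also fits \<open>c = 0\<close>,
  where the quotient is 0 / 0 = 0.\<close>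

lemma L2_angle_scale:
  assumes "f \<in> L2 \<Omega>" "\<not> L2_eq \<Omega> f (\<lambda>x. 0)"
  shows "L2_angle \<Omega> f (\<lambda>x. c * f x) = arccos (sgn c)"
proof -
  have pos: "0 < L2_inner \<Omega> f f"
    using L2_inner_self_pos[OF assms] .
  then have "L2_norm \<Omega> f * L2_norm \<Omega> f = L2_inner \<Omega> f f"
    by (simp add: L2_norm_def)
  then have "L2_norm \<Omega> f * (\<bar>c\<bar> * L2_norm \<Omega> f) = \<bar>c\<bar> * L2_inner \<Omega> f f"
    by (simp add: mult.left_commute)
  then have "L2_angle \<Omega> f (\<lambda>x. c * f x) = arccos (c * L2_inner \<Omega> f f / (\<bar>c\<bar> * L2_inner \<Omega> f f))"
    by (simp only: L2_angle_def L2_inner_scale_right L2_norm_scale)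
  then show ?thesis
    using pos by (simp add: sgn_if)
qed

theorem proposition11:
  fixes f g :: "real \<Rightarrow> real" and c :: real and \<Omega> :: "real set"
  assumes "\<Omega> = {0..1}"
    and "f \<in> L2 \<Omega>" and "g \<in> L2 \<Omega>"
    and "\<not> L2_eq \<Omega> f (\<lambda>x. 0)" and "\<not> L2_eq \<Omega> g (\<lambda>x. 0)"
    and "c \<noteq> 0"
    and "L2_eq \<Omega> g (\<lambda>x. c * f x)"
  shows "(c > 0 \<longrightarrow> L2_angle \<Omega> f g = 0) \<and> (c < 0 \<longrightarrow> L2_angle \<Omega> f g = pi)"
proof -
  \<comment> \<open>Replace the representative \<open>g\<close> by the exact multiple of
    \<open>f\<close>; the first argument stays fixed.\<close>
  have "L2_angle \<Omega> f g = L2_angle \<Omega> f (\<lambda>x. c * f x)"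
    using assms by (intro L2_angle_cong L2_scale L2_eq_refl)
  then show ?thesis
    using assms by (simp add: L2_angle_scale)
qed

end
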